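(* Let $m\ge 1$ be a fixed integer and let $W_n$ be the Wiener index of a random $m$-ary recursive tree with highest label $n$. Then $$\mathbb E[W_n]=\big(m(n-1)+1\big)(nm+1)\Big(\mathcal H^{(1)}_n\Big(\frac1m\Big)-\frac{mn}{mn+1}\Big)\ \sim\ m^2n^2\ln (n),\qquad\text{as } n\to\infty,$$ where the first equality is exact for every $n\ge 1$.
   Context: Fix an integer $m\ge 1$. The $m$-ary recursive tree grows as follows. It starts as a single root node labeled $1$. For each $n\ge 1$, given the tree with highest label $n$ (which has $m(n-1)+1$ nodes), one of its nodes is selected uniformly at random, and $m$ new nodes, all receiving the label $n+1$, are attached as children of the selected node. The Wiener index $W_n$ of the tree with highest label $n$ is the sum of the edge distances over all unordered pairs of nodes. For real $y>0$, $\mathcal H^{(1)}_n(y)=\sum_{i=1}^n\frac{1}{i+y}$. *)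

theory Defs
  imports
    "Graph_Theory.Digraph_Component"
    "Graph_Theory.Shortest_Path"
    "HOL-Probability.Probability_Mass_Function"
    "HOL-Library.Landau_Symbols"
begin

text \<open>
  The nodes of an m-ary recursive tree are numbered 0, 1, 2, ... in order of insertion, so that
  the root is 0 and each later label k occupies the next block of m numbers.
\<close>

definition nodes_labelled :: "nat \<Rightarrow> nat \<Rightarrow> nat set" where
  "nodes_labelled m k = (if k = 1 then {0} else {m * (k - 2) + 1 .. m * (k - 1)})"

text \<open>Rooted trees are digraphs whose arcs point from parent to child.\<close>

definition attach_children ::
  "nat \<Rightarrow> nat \<Rightarrow> nat \<Rightarrow> nat pair_pre_digraph \<Rightarrow> nat pair_pre_digraph" where
  "attach_children m k p T =
     \<lparr>pverts = pverts T \<union> nodes_labelled m k,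
      parcs = parcs T \<union> {p} \<times> nodes_labelled m k\<rparr>"

text \<open>The argument \<open>j\<close> counts the growth steps; after them the highest label is \<open>j + 1\<close>.\<close>

primrec recursive_tree_steps :: "nat \<Rightarrow> nat \<Rightarrow> nat pair_pre_digraph pmf" where
  "recursive_tree_steps m 0 = return_pmf \<lparr>pverts = nodes_labelled m 1, parcs = {}\<rparr>"
| "recursive_tree_steps m (Suc j) =
     bind_pmf (recursive_tree_steps m j) (\<lambda>T.
       map_pmf (\<lambda>p. attach_children m (j + 2) p T) (pmf_of_set (pverts T)))"

text \<open>Law of the m-ary recursive tree with highest label n, meaningful for n at least 1.\<close>

definition recursive_tree :: "nat \<Rightarrow> nat \<Rightarrow> nat pair_pre_digraph pmf" where
  "recursive_tree m n = recursive_tree_steps m (n - 1)"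

text \<open>
  Edge distance: least length of a walk in the underlying undirected graph. The library's
  shortest-path function takes values in the extended reals; on the vertices of a connected
  graph it is finite.
\<close>

definition edge_dist :: "'a pair_pre_digraph \<Rightarrow> 'a \<Rightarrow> 'a \<Rightarrow> real" where
  "edge_dist T u v =
     real_of_ereal (wf_digraph.\<mu> (with_proj (mk_symmetric (with_proj T))) (\<lambda>_. 1) u v)"

text \<open>Each unordered pair of distinct nodes is counted once, as the pair with \<open>u < v\<close>.\<close>

definition wiener_index :: "'a::linorder pair_pre_digraph \<Rightarrow> real" where
  "wiener_index T =
     (\<Sum>(u, v) \<in> {(u, v). u \<in> pverts T \<and> v \<in> pverts T \<and> u < v}. edge_dist T u v)"

definition shifted_harm :: "nat \<Rightarrow> real \<Rightarrow> real" where
  "shifted_harm n y = (\<Sum>i = 1..n. 1 / (real i + y))"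

end

(*
  Attaching m leaves to a node p of a tree with N nodes adds m * (sum of the distances to p)
  for paths to p, m * N for the last edges and 2 per pair of new leaves to the Wiener index W.
  The distances to a uniformly chosen p sum to 2 * W / N on average, so the expectation satisfies
    E' = E * (1 + 2 * m / N) + m * (N + m - 1)   with N = m * j + 1 after j steps,
  and the closed form solves this recurrence. The shifted harmonic number lies between
  harm n - 1 and harm n, which gives the asymptotics.
*)
theory Submission
  imports Defs "HOL-Analysis.Harmonic_Numbers" "HOL-Real_Asymp.Real_Asymp"
begin

section \<open>Certificates for graph distances\<close>

definition sym_arcs :: "'a pair_pre_digraph \<Rightarrow> ('a \<times> 'a) set" where
  "sym_arcs T = parcs T \<union> (parcs T)\<inverse>"

text \<open>
  The walk condition bounds the distance from above, and the Lipschitz condition along arcs bounds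
  it from below, so a distance function can be verified without minimising over walks.
\<close>

definition graph_metric :: "'a pair_pre_digraph \<Rightarrow> ('a \<Rightarrow> 'a \<Rightarrow> nat) \<Rightarrow> bool" where
  "graph_metric T d \<longleftrightarrow>
     (\<forall>u\<in>pverts T. d u u = 0) \<and>
     (\<forall>u\<in>pverts T. \<forall>v\<in>pverts T. d u v = d v u) \<and>
     (\<forall>u\<in>pverts T. \<forall>v\<in>pverts T. (u, v) \<in> sym_arcs T ^^ d u v) \<and>
     (\<forall>u\<in>pverts T. \<forall>(x, y)\<in>sym_arcs T. d u y \<le> d u x + 1)"

lemma graph_metricD:
  assumes "graph_metric T d" "u \<in> pverts T"
  shows "d u u = 0"
    and "v \<in> pverts T \<Longrightarrow> d u v = d v u"
    and "v \<in> pverts T \<Longrightarrow> (u, v) \<in> sym_arcs T ^^ d u v"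
    and "(x, y) \<in> sym_arcs T \<Longrightarrow> d u y \<le> d u x + 1"
  using assms unfolding graph_metric_def by blast+

text \<open>The Lipschitz condition is applied once per arc, starting from \<open>d u u = 0\<close>,
  so no walk can be shorter than \<open>d\<close> claims.\<close>

lemma graph_metric_le_walk:
  assumes "graph_metric T d" "u \<in> pverts T" "(u, v) \<in> sym_arcs T ^^ n"
  shows "d u v \<le> n"
  using assms(3)
proof (induction n arbitrary: v)
  case 0
  then show ?case using assms by (simp add: graph_metricD)
next
  case (Suc n)
  then obtain w where "(u, w) \<in> sym_arcs T ^^ n" "(w, v) \<in> sym_arcs T"
    by auto
  then show ?case
    using Suc.IH graph_metricD(4)[OF assms(1,2)] by fastforce
qed

section \<open>Undirected walks, edge distance and Wiener index\<close>

abbreviation undirected :: "'a pair_pre_digraph \<Rightarrow> ('a, 'a \<times> 'a) pre_digraph" where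
  "undirected T \<equiv> with_proj (mk_symmetric (with_proj T))"

lemma arcs_undirected: "arcs (undirected T) = sym_arcs T"
  by (auto simp: parcs_mk_symmetric sym_arcs_def)

lemma wf_undirected:
  assumes "parcs T \<subseteq> pverts T \<times> pverts T"
  shows "wf_digraph (undirected T)"
  using assms by unfold_locales (auto simp: parcs_mk_symmetric)

text \<open>Replaces walks given as arc lists by relational powers, which suit induction on the
  length. The start must be a vertex because the empty walk requires it, whereas the power 0 is the
  identity everywhere.\<close>

lemma awalk_undirected_iff:
  assumes "parcs T \<subseteq> pverts T \<times> pverts T" "u \<in> pverts T"
  shows "(\<exists>p. pre_digraph.awalk (undirected T) u p v \<and> length p = n) \<longleftrightarrow>
           (u, v) \<in> sym_arcs T ^^ n"
proof -
  interpret G: wf_digraph "undirected T"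
    by (rule wf_undirected) (rule assms)
  show ?thesis
    using assms(2)
  proof (induction n arbitrary: u)
    case 0
    then show ?case by (auto simp: G.awalk_Nil_iff)
  next
    case (Suc n)
    \<comment> \<open>Arcs stay inside the vertex set, so the induction hypothesis applies to the
      second vertex of the walk.\<close>
    have wf: "w \<in> pverts T" if "(u, w) \<in> sym_arcs T" for w
      using that assms(1) by (auto simp: sym_arcs_def)
    have "(\<exists>p. G.awalk u p v \<and> length p = Suc n) \<longleftrightarrow>
            (\<exists>w. (u, w) \<in> sym_arcs T \<and> (\<exists>p. G.awalk w p v \<and> length p = n))"
    proof (intro iffI; clarify)
      fix p
      assume "G.awalk u p v" "length p = Suc n"
      then obtain e q where "p = e # q" "e \<in> arcs (undirected T)" "u = fst e"
        "G.awalk (snd e) q v" "length q = n"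
        by (auto simp: length_Suc_conv G.awalk_Cons_iff)
      then show "\<exists>w. (u, w) \<in> sym_arcs T \<and> (\<exists>q. G.awalk w q v \<and> length q = n)"
        using arcs_undirected[of T] by (intro exI[of _ "snd e"]) auto
    next
      fix w p
      assume "(u, w) \<in> sym_arcs T" "G.awalk w p v" "n = length p"
      then show "\<exists>q. G.awalk u q v \<and> length q = Suc (length p)"
        using arcs_undirected[of T]
        by (intro exI[of _ "(u, w) # p"]) (simp add: G.awalk_Cons_iff)
    qed
    also have "\<dots> \<longleftrightarrow> (\<exists>w. (u, w) \<in> sym_arcs T \<and> (w, v) \<in> sym_arcs T ^^ n)"
      using Suc.IH wf by blast
    also have "\<dots> \<longleftrightarrow> (u, v) \<in> sym_arcs T ^^ Suc n"
      by (metis relpow_Suc_I2 relpow_Suc_E2)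
    finally show ?case .
  qed
qed

text \<open>The walk of length \<open>d u v\<close> bounds the infimum from above;
  \<open>graph_metric_le_walk\<close> bounds every competing walk from below. With unit costs the
  cost of a walk is its length.\<close>

lemma edge_dist_eq:
  assumes wf: "parcs T \<subseteq> pverts T \<times> pverts T"
    and d: "graph_metric T d" and u: "u \<in> pverts T" and v: "v \<in> pverts T"
  shows "edge_dist T u v = real (d u v)"
proof -
  interpret G: wf_digraph "undirected T"
    by (rule wf_undirected) (rule wf)
  have cost: "G.awalk_cost (\<lambda>_. 1) p = real (length p)" for p
    by (induction p) auto
  have "G.\<mu> (\<lambda>_. 1) u v = ereal (real (d u v))"
  proof (rule antisym)
    obtain p where "G.awalk u p v" "length p = d u v"
      using awalk_undirected_iff[OF wf u] graph_metricD(3)[OF d u v] by blast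
    then show "G.\<mu> (\<lambda>_. 1) u v \<le> ereal (real (d u v))"
      using G.min_cost_le_walk_cost cost by metis
    show "ereal (real (d u v)) \<le> G.\<mu> (\<lambda>_. 1) u v"
      unfolding G.\<mu>_def cost
    proof (rule INF_greatest, clarify)
      fix p
      assume "G.awalk u p v"
      then have "(u, v) \<in> sym_arcs T ^^ length p"
        using awalk_undirected_iff[OF wf u] by blast
      then show "ereal (real (d u v)) \<le> ereal (real (length p))"
        using graph_metric_le_walk[OF d u] by simp
    qed
  qed
  then show ?thesis by (simp add: edge_dist_def)
qed

text \<open>By symmetry the pairs above and below the diagonal contribute equally, and the diagonal
  contributes 0. The sum over ordered pairs is independent of the numbering and splits easily into
  blocks.\<close>

lemma wiener_index_eq:
  assumes "parcs T \<subseteq> pverts T \<times> pverts T" "finite (pverts T)" "graph_metric T d"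
  shows "2 * wiener_index T = (\<Sum>u\<in>pverts T. \<Sum>v\<in>pverts T. real (d u v))"
proof -
  let ?V = "pverts T"
  let ?A = "{(u, v). u \<in> ?V \<and> v \<in> ?V \<and> u < v}"
  let ?B = "{(u, v). u \<in> ?V \<and> v \<in> ?V \<and> v < u}"
  let ?D = "{(u, v). u \<in> ?V \<and> v \<in> ?V \<and> u = v}"
  let ?f = "\<lambda>(u, v). real (d u v)"
  have fin: "finite ?A" "finite ?B" "finite ?D"
    using assms(2) by (auto intro: finite_subset[of _ "?V \<times> ?V"])
  have "wiener_index T = sum ?f ?A"
    unfolding wiener_index_def
    by (intro sum.cong) (auto simp: edge_dist_eq[OF assms(1,3)])
  moreover have "sum ?f ?B = sum ?f ?A"
    by (rule sum.reindex_bij_witness[of _ prod.swap prod.swap])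
       (auto simp: graph_metricD(2)[OF assms(3)])
  moreover have "sum ?f ?D = 0"
    by (intro sum.neutral) (auto simp: graph_metricD(1)[OF assms(3)])
  moreover have "sum ?f (?V \<times> ?V) = sum ?f ?A + sum ?f ?B + sum ?f ?D"
  proof -
    have "?V \<times> ?V = (?A \<union> ?B) \<union> ?D" by auto
    moreover have "sum ?f ((?A \<union> ?B) \<union> ?D) = sum ?f (?A \<union> ?B) + sum ?f ?D"
      using fin by (intro sum.union_disjoint) auto
    moreover have "sum ?f (?A \<union> ?B) = sum ?f ?A + sum ?f ?B"
      using fin by (intro sum.union_disjoint) auto
    ultimately show ?thesis by simp
  qed
  ultimately show ?thesis
    by (simp add: sum.cartesian_product)
qed

section \<open>Effect of attaching leaves to a node\<close>

definition attach_metric :: "'a set \<Rightarrow> 'a \<Rightarrow> ('a \<Rightarrow> 'a \<Rightarrow> nat) \<Rightarrow> 'a \<Rightarrow> 'a \<Rightarrow> nat" where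
  "attach_metric L p d u v =
     (if u \<in> L then if v \<in> L then if u = v then 0 else 2 else d p v + 1
      else if v \<in> L then d u p + 1 else d u v)"

text \<open>The new nodes are adjacent only to \<open>p\<close>, so old distances persist and every
  connection from a new node to another node runs through \<open>p\<close>. Walks are extended by
  the arcs at \<open>p\<close>, and the Lipschitz condition is checked for old arcs and for both
  directions of the new ones.\<close>

lemma graph_metric_attach:
  assumes wf: "parcs T \<subseteq> pverts T \<times> pverts T" and d: "graph_metric T d"
    and p: "p \<in> pverts T" and disj: "pverts T \<inter> nodes_labelled m k = {}"
  shows "graph_metric (attach_children m k p T) (attach_metric (nodes_labelled m k) p d)"
proof -
  let ?L = "nodes_labelled m k" and ?V = "pverts T"
  let ?T = "attach_children m k p T"
  let ?d = "attach_metric ?L p d"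
  have V: "pverts ?T = ?V \<union> ?L"
    by (simp add: attach_children_def)
  have S: "sym_arcs ?T = sym_arcs T \<union> {p} \<times> ?L \<union> ?L \<times> {p}"
    by (auto simp: attach_children_def sym_arcs_def)
  have SV: "sym_arcs T \<subseteq> ?V \<times> ?V"
    using wf by (auto simp: sym_arcs_def)
  note D = graph_metricD[OF d]
  have mono: "(u, v) \<in> sym_arcs ?T ^^ n" if "(u, v) \<in> sym_arcs T ^^ n" for u v n
    using that by (induction n arbitrary: v) (auto simp: S)
  have notL: "x \<notin> ?L" if "x \<in> ?V" for x using that disj by auto
  have walk: "(u, v) \<in> sym_arcs ?T ^^ ?d u v" if "u \<in> ?V \<union> ?L" "v \<in> ?V \<union> ?L" for u v
  proof (cases "u \<in> ?L"; cases "v \<in> ?L")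
    assume uv: "u \<in> ?L" "v \<in> ?L"
    \<comment> \<open>This is the walk from \<open>u\<close> to \<open>p\<close> to
      \<open>v\<close>; if \<open>u = v\<close>, the claimed distance is 0 and the empty walk serves
      instead.\<close>
    have "(u, v) \<in> sym_arcs ?T ^^ 2"
      using uv S by (auto simp: numeral_2_eq_2 relcomp_unfold)
    then show ?thesis using uv by (auto simp: attach_metric_def)
  next
    assume uv: "u \<in> ?L" "v \<notin> ?L"
    then have "(p, v) \<in> sym_arcs ?T ^^ d p v" "(u, p) \<in> sym_arcs ?T"
      using that D(3)[OF p] mono S by auto
    \<comment> \<open>The new arc comes first here, so the old walk is extended at its
      front.\<close>
    then show ?thesis
      using uv relpow_Suc_I2 by (fastforce simp: attach_metric_def)
  next
    assume uv: "u \<notin> ?L" "v \<in> ?L"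
    then have "(u, p) \<in> sym_arcs ?T ^^ d u p" "(p, v) \<in> sym_arcs ?T"
      using that D(3)[OF _ p] mono S by auto
    then show ?thesis
      using uv by (auto simp: attach_metric_def)
  next
    assume uv: "u \<notin> ?L" "v \<notin> ?L"
    then show ?thesis using that D(3) mono by (auto simp: attach_metric_def)
  qed
  have lip: "?d u y \<le> ?d u x + 1" if u: "u \<in> ?V \<union> ?L" and xy: "(x, y) \<in> sym_arcs ?T" for u x y
  proof -
    from xy consider "(x, y) \<in> sym_arcs T" | "x = p" "y \<in> ?L" | "x \<in> ?L" "y = p"
      unfolding S by blast
    then show ?thesis
    proof cases
      case 1
      then have "x \<in> ?V" "y \<in> ?V" using SV by auto
      then show ?thesis
        using 1 u notL D(4)[OF _ 1] p by (auto simp: attach_metric_def)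
    next
      case 2
      then show ?thesis using u notL p D(1) by (auto simp: attach_metric_def)
    next
      case 3
      then show ?thesis using u notL p D(1) by (auto simp: attach_metric_def)
    qed
  qed
  have "?d u u = 0" if "u \<in> ?V \<union> ?L" for u
    using that D(1) by (auto simp: attach_metric_def)
  moreover have "?d u v = ?d v u" if "u \<in> ?V \<union> ?L" "v \<in> ?V \<union> ?L" for u v
    using that D(2) p by (auto simp: attach_metric_def)
  ultimately show ?thesis
    using walk lip unfolding graph_metric_def V by auto
qed

text \<open>The doubled index is a sum over four blocks: old-old, old-new, new-old and new-new. The
  two mixed blocks agree, and halving the total gives the formula.\<close>

lemma wiener_index_attach:
  fixes T :: "nat pair_pre_digraph"
  assumes wf: "parcs T \<subseteq> pverts T \<times> pverts T" and fin: "finite (pverts T)"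
    and d: "graph_metric T d"
    and p: "p \<in> pverts T" and disj: "pverts T \<inter> nodes_labelled m k = {}"
    and card: "card (nodes_labelled m k) = m"
  shows "wiener_index (attach_children m k p T) =
           wiener_index T + real m * (\<Sum>v\<in>pverts T. real (d p v))
             + real m * (real (card (pverts T)) + real m - 1)"
proof -
  let ?L = "nodes_labelled m k" and ?V = "pverts T"
  let ?T = "attach_children m k p T"
  let ?d = "attach_metric ?L p d"
  let ?S = "\<Sum>v\<in>?V. real (d p v)"
  have V: "pverts ?T = ?V \<union> ?L"
    by (simp add: attach_children_def)
  have finL: "finite ?L" by (simp add: nodes_labelled_def)
  have wf': "parcs ?T \<subseteq> pverts ?T \<times> pverts ?T"
    using wf p by (auto simp: attach_children_def)
  have notL: "x \<notin> ?L" if "x \<in> ?V" for x using that disj by auto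
  have split: "(\<Sum>v\<in>?V \<union> ?L. f v) = sum f ?V + sum f ?L" for f :: "nat \<Rightarrow> real"
    using fin finL disj by (rule sum.union_disjoint)
  have VV: "(\<Sum>u\<in>?V. \<Sum>v\<in>?V. real (?d u v)) = 2 * wiener_index T"
    unfolding wiener_index_eq[OF wf fin d]
    by (intro sum.cong) (auto simp: attach_metric_def notL)
  have VL: "(\<Sum>u\<in>?V. \<Sum>v\<in>?L. real (?d u v)) = real m * ?S + real m * real (card ?V)"
  proof -
    have "(\<Sum>u\<in>?V. \<Sum>v\<in>?L. real (?d u v)) = (\<Sum>u\<in>?V. \<Sum>v\<in>?L. real (d p u) + 1)"
      using graph_metricD(2)[OF d] p
      by (intro sum.cong) (auto simp: attach_metric_def notL)
    then show ?thesis
      by (simp add: card sum.distrib sum_distrib_left algebra_simps)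
  qed
  have LV: "(\<Sum>u\<in>?L. \<Sum>v\<in>?V. real (?d u v)) = real m * ?S + real m * real (card ?V)"
  proof -
    have "(\<Sum>u\<in>?L. \<Sum>v\<in>?V. real (?d u v)) = (\<Sum>u\<in>?L. \<Sum>v\<in>?V. real (d p v) + 1)"
      by (intro sum.cong) (auto simp: attach_metric_def notL)
    then show ?thesis
      by (simp add: card sum.distrib algebra_simps)
  qed
  have LL: "(\<Sum>u\<in>?L. \<Sum>v\<in>?L. real (?d u v)) = real m * (2 * real m - 2)"
  proof -
    have "(\<Sum>v\<in>?L. real (?d u v)) = 2 * real m - 2" if "u \<in> ?L" for u
    proof -
      \<comment> \<open>Each leaf sees distance 2 everywhere except at itself, written as a constant
        minus a correction on the diagonal.\<close>
      have "(\<Sum>v\<in>?L. real (?d u v)) = (\<Sum>v\<in>?L. 2 - (if u = v then 2 else 0))"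
        using that by (intro sum.cong) (auto simp: attach_metric_def)
      also have "\<dots> = 2 * real m - 2"
        using that finL by (simp add: sum_subtractf card)
      finally show ?thesis .
    qed
    then show ?thesis by (simp add: card)
  qed
  have "2 * wiener_index ?T = (\<Sum>u\<in>?V \<union> ?L. \<Sum>v\<in>?V \<union> ?L. real (?d u v))"
    using wiener_index_eq[OF wf' _ graph_metric_attach[OF wf d p disj]] fin finL
    unfolding V by simp
  also have "\<dots> = 2 * wiener_index T + 2 * (real m * ?S + real m * real (card ?V))
      + real m * (2 * real m - 2)"
    unfolding split sum.distrib VV VL LV LL by simp
  finally show ?thesis by (simp add: algebra_simps)
qed

section \<open>Random growth and the recurrence for the expectation\<close>

lemma nodes_labelled_step:
  "nodes_labelled m (j + 2) = {m * j + 1 .. m * Suc j}"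
  by (simp add: nodes_labelled_def)

text \<open>The invariant of the growth. The vertex set is the same for all outcomes, while the
  metric varies with the tree and is therefore only asserted to exist. For the root alone the
  constant 0 works.\<close>

lemma recursive_tree_steps_support:
  assumes "T \<in> set_pmf (recursive_tree_steps m j)"
  shows "pverts T = {..m * j} \<and> parcs T \<subseteq> pverts T \<times> pverts T \<and> (\<exists>d. graph_metric T d)"
  using assms
proof (induction j arbitrary: T)
  case 0
  then show ?case
    by (auto simp: nodes_labelled_def graph_metric_def sym_arcs_def intro: exI[of _ "\<lambda>_ _. 0"])
next
  case (Suc j)
  from Suc.prems obtain T' p where T': "T' \<in> set_pmf (recursive_tree_steps m j)"
    and p: "p \<in> set_pmf (pmf_of_set (pverts T'))" and T: "T = attach_children m (j + 2) p T'"
    by auto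
  from Suc.IH[OF T'] obtain d where IH: "pverts T' = {..m * j}"
    "parcs T' \<subseteq> pverts T' \<times> pverts T'" "graph_metric T' d" by auto
  have p': "p \<in> pverts T'" using p IH(1) by (simp add: set_pmf_of_set)
  have disj: "pverts T' \<inter> nodes_labelled m (j + 2) = {}"
    unfolding nodes_labelled_step IH(1) by auto
  have "pverts T = {..m * Suc j}"
    unfolding T attach_children_def pair_pre_digraph.simps nodes_labelled_step IH(1) by auto
  moreover have "parcs T \<subseteq> pverts T \<times> pverts T"
    using IH(2) p' by (auto simp: T attach_children_def)
  ultimately show ?case
    using graph_metric_attach[OF IH(2,3) p' disj] T by auto
qed

text \<open>Finite support turns the expectations into finite sums and settles
  integrability.\<close>

lemma finite_set_recursive_tree_steps: "finite (set_pmf (recursive_tree_steps m j))"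
proof (induction j)
  case (Suc j)
  have "finite (set_pmf (pmf_of_set (pverts T)))"
    if "T \<in> set_pmf (recursive_tree_steps m j)" for T
    using recursive_tree_steps_support[OF that] by (simp add: set_pmf_of_set)
  then show ?case using Suc by simp
qed simp

text \<open>The conditional mean given the current tree. Summing the distances to \<open>p\<close>
  over all \<open>p\<close> gives twice the index, whence the factor \<open>2 * m / N\<close> after
  division by \<open>N = m * j + 1\<close>; the additive term is
  \<open>m * (N + m - 1) = m^2 * (j + 1)\<close>.\<close>

lemma expectation_wiener_index_attach:
  assumes T: "T \<in> set_pmf (recursive_tree_steps m j)"
  shows "measure_pmf.expectation
           (map_pmf (\<lambda>p. attach_children m (j + 2) p T) (pmf_of_set (pverts T))) wiener_index =
         wiener_index T * (1 + 2 * real m / (real m * real j + 1)) + (real m)\<^sup>2 * (real j + 1)"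
proof -
  obtain d where V: "pverts T = {..m * j}"
    and wf: "parcs T \<subseteq> pverts T \<times> pverts T" and d: "graph_metric T d"
    using recursive_tree_steps_support[OF T] by auto
  have fin: "finite (pverts T)" "pverts T \<noteq> {}" using V by auto
  have c: "real (card (pverts T)) = real m * real j + 1" using V by simp
  have pos: "real m * real j + 1 > 0"
    by (simp add: add_nonneg_pos)
  have disj: "pverts T \<inter> nodes_labelled m (j + 2) = {}"
    unfolding nodes_labelled_step V by auto
  have card: "card (nodes_labelled m (j + 2)) = m"
    unfolding nodes_labelled_step by simp
  have "measure_pmf.expectation
           (map_pmf (\<lambda>p. attach_children m (j + 2) p T) (pmf_of_set (pverts T))) wiener_index =
        (\<Sum>p\<in>pverts T. wiener_index (attach_children m (j + 2) p T)) / (real m * real j + 1)"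
    \<comment> \<open>The deleted rule would turn \<open>j + 2\<close> into successors, away from
      the form used in the next step.\<close>
    using fin by (simp add: integral_pmf_of_set c del: add_2_eq_Suc')
  also have "(\<Sum>p\<in>pverts T. wiener_index (attach_children m (j + 2) p T)) =
      (\<Sum>p\<in>pverts T. wiener_index T + real m * (\<Sum>v\<in>pverts T. real (d p v))
         + real m * (real m * real j + 1 + real m - 1))"
    by (intro sum.cong refl) (subst wiener_index_attach[OF wf fin(1) d _ disj card], auto simp: c)
  also have "\<dots> = (real m * real j + 1) * wiener_index T + real m * (2 * wiener_index T)
      + (real m * real j + 1) * (real m * (real m * real j + real m))"
    \<comment> \<open>Only the isolated \<open>2 * wiener_index T\<close> is expanded, to match the
      double sum over \<open>p\<close> and \<open>v\<close>.\<close>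
    unfolding wiener_index_eq[OF wf fin(1) d]
    by (simp add: sum.distrib c sum_distrib_left algebra_simps)
  finally show ?thesis
    using pos by (simp add: field_simps power2_eq_square)
qed

text \<open>The conditional mean is affine in the current index with coefficients common to all
  trees of the same size, so averaging over the trees closes the recurrence.\<close>

lemma expectation_wiener_index_Suc:
  "measure_pmf.expectation (recursive_tree_steps m (Suc j)) wiener_index =
     measure_pmf.expectation (recursive_tree_steps m j) wiener_index
       * (1 + 2 * real m / (real m * real j + 1)) + (real m)\<^sup>2 * (real j + 1)"
proof -
  let ?P = "recursive_tree_steps m j"
  let ?a = "1 + 2 * real m / (real m * real j + 1)" and ?b = "(real m)\<^sup>2 * (real j + 1)"
  let ?Q = "\<lambda>T. map_pmf (\<lambda>p. attach_children m (j + 2) p T) (pmf_of_set (pverts T))"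
  have fin: "finite (set_pmf ?P)" by (rule finite_set_recursive_tree_steps)
  have "measure_pmf.expectation (recursive_tree_steps m (Suc j)) wiener_index =
     (\<Sum>T\<in>set_pmf ?P. pmf ?P T *\<^sub>R measure_pmf.expectation (?Q T) wiener_index)"
    unfolding recursive_tree_steps.simps
    using fin recursive_tree_steps_support
    by (intro pmf_expectation_bind) (auto simp: set_pmf_of_set)
  also have "\<dots> = (\<Sum>T\<in>set_pmf ?P. pmf ?P T *\<^sub>R (wiener_index T * ?a + ?b))"
    by (intro sum.cong refl) (simp only: expectation_wiener_index_attach)
  also have "\<dots> = measure_pmf.expectation ?P (\<lambda>T. wiener_index T * ?a + ?b)"
    by (subst integral_measure_pmf[OF fin]) auto
  also have "\<dots> = measure_pmf.expectation ?P wiener_index * ?a + ?b"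
    using fin by (simp add: integrable_measure_pmf_finite)
  finally show ?thesis .
qed

text \<open>The growth factor times \<open>m * j + 1\<close> equals \<open>m * (j + 2) + 1\<close>,
  so a product of two consecutive linear factors solves the homogeneous recurrence; the bracket
  absorbs the additive term. At \<open>j = 0\<close> there are no pairs and the bracket
  vanishes.\<close>

lemma expectation_wiener_index_steps:
  assumes "m \<ge> 1"
  shows "measure_pmf.expectation (recursive_tree_steps m j) wiener_index =
           (real m * real j + 1) * (real (Suc j) * real m + 1) *
             (shifted_harm (Suc j) (1 / real m) -
               real m * real (Suc j) / (real m * real (Suc j) + 1))"
proof (induction j)
  case 0
  have "measure_pmf.expectation (recursive_tree_steps m 0) wiener_index = 0"
    by (auto simp: wiener_index_def nodes_labelled_def intro!: sum.neutral)
  moreover have "shifted_harm (Suc 0) (1 / real m) = real m / (real m + 1)"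
    using assms by (simp add: shifted_harm_def field_simps)
  ultimately show ?case by simp
next
  case (Suc j)
  define x where "x = real m"
  define y where "y = real j"
  define h where "h = shifted_harm (Suc j) (1 / real m)"
  have x: "x > 0" and y: "y \<ge> 0" using assms by (auto simp: x_def y_def)
  have ne: "x * y + 1 \<noteq> 0" "x * (y + 1) + 1 \<noteq> 0" "x * (y + 2) + 1 \<noteq> 0"
    using x y by (smt (verit) mult_nonneg_nonneg)+
  have "y + 2 + 1 / x = (x * (y + 2) + 1) / x" using x by (simp add: field_simps)
  then have h: "shifted_harm (Suc (Suc j)) (1 / real m) = h + x / (x * (y + 2) + 1)"
    by (simp add: shifted_harm_def h_def x_def y_def add_ac)
  have alg: "(x * y + 1) * ((y + 1) * x + 1) * (h - x * (y + 1) / (x * (y + 1) + 1))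
        * (1 + 2 * x / (x * y + 1)) + x\<^sup>2 * (y + 1) =
      (x * (y + 1) + 1) * ((y + 2) * x + 1) *
        (h + x / (x * (y + 2) + 1) - x * (y + 2) / (x * (y + 2) + 1))"
  proof -
    \<comment> \<open>Each product clears one denominator, leaving a polynomial identity for
      \<open>algebra\<close>. The instantiated rules distribute only the outer products, so that the
      denominators still cancel as whole factors.\<close>
    have "(x * y + 1) * (1 + 2 * x / (x * y + 1)) = x * (y + 2) + 1"
      "(x * (y + 1) + 1) * (h - x * (y + 1) / (x * (y + 1) + 1)) =
         (x * (y + 1) + 1) * h - x * (y + 1)"
      "(x * (y + 2) + 1) * (h + x / (x * (y + 2) + 1) - x * (y + 2) / (x * (y + 2) + 1)) =
         (x * (y + 2) + 1) * h + x - x * (y + 2)"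
      unfolding distrib_left[of _ h] distrib_left[of _ 1] right_diff_distrib
      using ne by (simp_all add: distrib_left[of x])
    then show ?thesis by algebra
  qed
  have reals: "real (Suc j) = y + 1" "real (Suc (Suc j)) = y + 2" by (auto simp: y_def)
  show ?case
    using alg unfolding expectation_wiener_index_Suc Suc.IH h reals x_def y_def h_def .
qed

section \<open>Asymptotics of the shifted harmonic numbers\<close>

lemma harm_over_ln_tendsto: "(\<lambda>n. harm n / ln (real n)) \<longlonglongrightarrow> 1"
proof -
  \<comment> \<open>\<open>harm n - ln n\<close> converges to the Euler-Mascheroni constant, so it
    vanishes after division by \<open>ln n\<close>.\<close>
  have "(\<lambda>n. (harm n - ln (real n)) * (1 / ln (real n)) + 1) \<longlonglongrightarrow> euler_mascheroni * 0 + (1::real)"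
    by (intro tendsto_intros euler_mascheroni_LIMSEQ) real_asymp
  moreover have "eventually (\<lambda>n. (harm n - ln (real n)) * (1 / ln (real n)) + 1 =
      harm n / ln (real n)) sequentially"
    using eventually_gt_at_top[of 1] by eventually_elim (simp add: field_simps)
  ultimately show ?thesis
    using tendsto_cong by fastforce
qed

text \<open>Termwise, \<open>1 / (i + 1) <= 1 / (i + y) <= 1 / i\<close>, which squeezes the sum
  between \<open>harm n - 1\<close> and \<open>harm n\<close>.\<close>

lemma shifted_harm_over_ln_tendsto:
  assumes "0 \<le> y" "y \<le> 1"
  shows "(\<lambda>n. shifted_harm n y / ln (real n)) \<longlonglongrightarrow> 1"
proof (rule tendsto_sandwich[OF _ _ _ harm_over_ln_tendsto])
  have "(\<lambda>n. harm n / ln (real n) - 1 / ln (real n)) \<longlonglongrightarrow> 1 - 0"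
    by (intro tendsto_intros harm_over_ln_tendsto) real_asymp
  then show "(\<lambda>n. (harm n - 1) / ln (real n)) \<longlonglongrightarrow> 1"
    by (simp add: diff_divide_distrib)
  have "harm n - 1 \<le> shifted_harm n y" for n
  proof -
    \<comment> \<open>Both sides are the harmonic number of \<open>n + 1\<close>: once with its last
      term split off, once with its first.\<close>
    have "harm n + 1 / (real n + 1) = 1 + (\<Sum>i = 1..n. 1 / (real i + 1))"
      by (induction n) (simp_all add: harm_Suc harm_expand inverse_eq_divide add_ac)
    moreover have "(\<Sum>i = 1..n. 1 / (real i + 1)) \<le> shifted_harm n y"
      unfolding shifted_harm_def using assms
      by (intro sum_mono divide_left_mono) auto
    moreover have "1 / (real n + 1) \<ge> 0" by simp
    ultimately show ?thesis by linarith
  qed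
  then show "eventually (\<lambda>n. (harm n - 1) / ln (real n) \<le> shifted_harm n y / ln (real n)) sequentially"
    by (intro eventually_mono[OF eventually_gt_at_top[of 1]] divide_right_mono) auto
  have "shifted_harm n y \<le> harm n" for n
    unfolding shifted_harm_def harm_def using assms
    by (intro sum_mono) (auto simp: field_simps)
  then show "eventually (\<lambda>n. shifted_harm n y / ln (real n) \<le> harm n / ln (real n)) sequentially"
    by (intro eventually_mono[OF eventually_gt_at_top[of 1]] divide_right_mono) auto
qed

theorem proposition6p1:
  fixes m :: nat
  assumes "m \<ge> 1"
  shows "(\<forall>n::nat. n \<ge> 1 \<longrightarrow>
            measure_pmf.expectation (recursive_tree m n) wiener_index =
              (real m * (real n - 1) + 1) * (real n * real m + 1) *
              (shifted_harm n (1 / real m) - real m * real n / (real m * real n + 1)))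
       \<and> (\<lambda>n. measure_pmf.expectation (recursive_tree m n) wiener_index)
            \<sim>[at_top] (\<lambda>n. (real m)\<^sup>2 * (real n)\<^sup>2 * ln (real n))"
    (is "?exact \<and> ?asymp")
proof
  let ?x = "real m" and ?h = "\<lambda>n. shifted_harm n (1 / real m)"
  show exact: ?exact
  proof (intro allI impI)
    fix n :: nat
    assume "n \<ge> 1"
    \<comment> \<open>The subtraction on naturals is truncated; \<open>n >= 1\<close> makes it agree
      with the real one.\<close>
    then have "Suc (n - 1) = n" "real (n - 1) = real n - 1" by auto
    then show "measure_pmf.expectation (recursive_tree m n) wiener_index =
        (?x * (real n - 1) + 1) * (real n * ?x + 1) *
        (?h n - ?x * real n / (?x * real n + 1))"
      using expectation_wiener_index_steps[OF assms, of "n - 1"]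
      by (simp add: recursive_tree_def)
  qed
  have x: "?x > 0" using assms by simp
  \<comment> \<open>The quotient is arranged as a rational prefactor tending to 1 times a bracket in
    which only the harmonic part survives division by \<open>ln n\<close>.\<close>
  have "(\<lambda>n. ((?x * (real n - 1) + 1) * (real n * ?x + 1) / (?x\<^sup>2 * (real n)\<^sup>2)) *
      (?h n / ln (real n) - ?x * real n / (?x * real n + 1) / ln (real n))) \<longlonglongrightarrow> 1 * (1 - 0)"
  proof (intro tendsto_mult tendsto_diff shifted_harm_over_ln_tendsto)
    show "(\<lambda>n. (?x * (real n - 1) + 1) * (real n * ?x + 1) / (?x\<^sup>2 * (real n)\<^sup>2)) \<longlonglongrightarrow> 1"
      unfolding power2_eq_square using x by real_asymp (simp add: field_simps)
    show "(\<lambda>n. ?x * real n / (?x * real n + 1) / ln (real n)) \<longlonglongrightarrow> 0"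
      using x by real_asymp
  qed (use assms in auto)
  moreover have "eventually (\<lambda>n. ((?x * (real n - 1) + 1) * (real n * ?x + 1) / (?x\<^sup>2 * (real n)\<^sup>2)) *
      (?h n / ln (real n) - ?x * real n / (?x * real n + 1) / ln (real n)) =
      measure_pmf.expectation (recursive_tree m n) wiener_index /
        (?x\<^sup>2 * (real n)\<^sup>2 * ln (real n))) sequentially"
    \<comment> \<open>The exact formula needs \<open>n >= 1\<close>. The rearrangement of fractions
      also holds at \<open>n = 1\<close>, where \<open>ln n = 0\<close>, since division by zero
      yields 0.\<close>
    using eventually_ge_at_top[of 1]
  proof eventually_elim
    case (elim n)
    then show ?case
      by (simp only: exact[rule_format, OF elim] diff_divide_distrib[symmetric] times_divide_times_eq)
  qed
  ultimately have "(\<lambda>n. measure_pmf.expectation (recursive_tree m n) wiener_index /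
        (?x\<^sup>2 * (real n)\<^sup>2 * ln (real n))) \<longlonglongrightarrow> 1"
    using tendsto_cong by fastforce
  then show ?asymp by (rule asymp_equivI')
qed

end
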